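(* Let $G$ be a connected graph. If $$|E(G)|>1+\max_{P\in\mathbf{P}}\sum_{v\in V(P)}\left(d_{\widehat{G}}(v)-1\right),$$ where $\mathbf{P}$ is the set of all shortest paths in $S(G)$ connecting vertices $w_{ij}$ (subdivision vertices), then $\widehat{G}\notin\mathfrak{N}$.
   Context: All graphs are finite, without loops or multiple edges. An interval $t$-coloring of a graph $H$ is a proper edge-coloring of $H$ with colors $1,\ldots,t$ such that every color is used and for every vertex $v$ the set of colors of edges incident to $v$ is an interval of integers. $\mathfrak{N}$ denotes the set of graphs having an interval $t$-coloring for some positive integer $t$. For a graph $G$ with vertices $v_1,\ldots,v_n$, $S(G)$ is the graph with vertex set $\{v_1,\ldots,v_n\}\cup\{w_{ij}:v_iv_j\in E(G)\}$ and edge set $\{v_iw_{ij},v_jw_{ij}:v_iv_j\in E(G)\}$ (every edge subdivided once). $\widehat{G}$ is obtained from $S(G)$ by adding a new vertex $u$ and the edges $uw_{ij}$ for all $v_iv_j\in E(G)$. $d_{\widehat{G}}(v)$ denotes the degree of $v$ in $\widehat{G}$; $V(P)$ is the vertex set of path $P$. *)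

theory Defs
  imports Main
begin

record 'a ugraph =
  verts :: "'a set"
  edges :: "'a set set"

definition simple_graph :: "'a ugraph \<Rightarrow> bool" where
  "simple_graph G \<longleftrightarrow> finite (verts G) \<and> (\<forall>e\<in>edges G. e \<subseteq> verts G \<and> card e = 2)"

definition degree :: "'a ugraph \<Rightarrow> 'a \<Rightarrow> nat" where
  "degree G v = card {e \<in> edges G. v \<in> e}"

text \<open>A path is given by the list of its vertices; a single vertex is a path of length 0.\<close>

definition path_between :: "'a ugraph \<Rightarrow> 'a \<Rightarrow> 'a list \<Rightarrow> 'a \<Rightarrow> bool" where
  "path_between G x p y \<longleftrightarrow>
     p \<noteq> [] \<and> hd p = x \<and> last p = y \<and> set p \<subseteq> verts G \<and> distinct p \<and>
     (\<forall>i. Suc i < length p \<longrightarrow> {p ! i, p ! Suc i} \<in> edges G)"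

definition shortest_path_between :: "'a ugraph \<Rightarrow> 'a \<Rightarrow> 'a list \<Rightarrow> 'a \<Rightarrow> bool" where
  "shortest_path_between G x p y \<longleftrightarrow>
     path_between G x p y \<and> (\<forall>q. path_between G x q y \<longrightarrow> length p \<le> length q)"

definition connected_graph :: "'a ugraph \<Rightarrow> bool" where
  "connected_graph G \<longleftrightarrow>
     verts G \<noteq> {} \<and> (\<forall>x\<in>verts G. \<forall>y\<in>verts G. \<exists>p. path_between G x p y)"

definition proper_edge_coloring :: "'a ugraph \<Rightarrow> ('a set \<Rightarrow> nat) \<Rightarrow> bool" where
  "proper_edge_coloring H c \<longleftrightarrow>
     (\<forall>e\<in>edges H. \<forall>f\<in>edges H. e \<noteq> f \<and> e \<inter> f \<noteq> {} \<longrightarrow> c e \<noteq> c f)"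

text \<open>The interval at an isolated vertex is empty, which is the case \<^term>\<open>b < a\<close> below.\<close>

definition interval_coloring :: "'a ugraph \<Rightarrow> nat \<Rightarrow> ('a set \<Rightarrow> nat) \<Rightarrow> bool" where
  "interval_coloring H t c \<longleftrightarrow>
     proper_edge_coloring H c \<and> c ` edges H = {1..t} \<and>
     (\<forall>v\<in>verts H. \<exists>a b. c ` {e \<in> edges H. v \<in> e} = {a..b})"

definition interval_colorable :: "'a ugraph set" where
  "interval_colorable = {H. \<exists>t>0. \<exists>c. interval_coloring H t c}"

text \<open>\<open>Subdiv {x, y}\<close> is the vertex subdividing the edge \<open>{x, y}\<close>.\<close>

datatype 'a hat_vertex = Orig 'a | Subdiv "'a set" | Apex

definition subdivision :: "'a ugraph \<Rightarrow> 'a hat_vertex ugraph" where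
  "subdivision G =
     \<lparr>verts = Orig ` verts G \<union> Subdiv ` edges G,
      edges = {{Orig v, Subdiv e} | v e. e \<in> edges G \<and> v \<in> e}\<rparr>"

definition hat_graph :: "'a ugraph \<Rightarrow> 'a hat_vertex ugraph" where
  "hat_graph G =
     \<lparr>verts = insert Apex (verts (subdivision G)),
      edges = edges (subdivision G) \<union> {{Apex, Subdiv e} | e. e \<in> edges G}\<rparr>"

text \<open>The two ends may coincide, so one-vertex paths are included.  Hence the set is nonempty
  as soon as \<open>G\<close> has an edge.\<close>

definition subdiv_shortest_paths :: "'a ugraph \<Rightarrow> 'a hat_vertex list set" where
  "subdiv_shortest_paths G =
     {p. \<exists>e\<in>edges G. \<exists>f\<in>edges G.
           shortest_path_between (subdivision G) (Subdiv e) p (Subdiv f)}"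

end

theory Submission
  imports Defs
begin

text \<open>The edges at the apex carry \<open>|E(G)|\<close> consecutive colors. Join the subdivision vertices
  of the edges with the smallest and the largest of these colors by a shortest path in \<open>S(G)\<close>
  and close it up through the apex. Two consecutive edges of this closed walk meeting in \<open>v\<close> have
  colors differing by at most \<open>d(v) - 1\<close>, so \<open>|E(G)| - 1\<close> is at most the sum of \<open>d(v) - 1\<close>
  over the path.\<close>

definition walk_between :: "'a ugraph \<Rightarrow> 'a \<Rightarrow> 'a list \<Rightarrow> 'a \<Rightarrow> bool" where
  "walk_between H x p y \<longleftrightarrow>
     p \<noteq> [] \<and> hd p = x \<and> last p = y \<and> set p \<subseteq> verts H \<and>
     successively (\<lambda>u v. {u, v} \<in> edges H) p"

definition reachable :: "'a ugraph \<Rightarrow> 'a \<Rightarrow> 'a \<Rightarrow> bool" where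
  "reachable H x y \<longleftrightarrow> (\<exists>p. walk_between H x p y)"

definition incident_edges :: "'a ugraph \<Rightarrow> 'a \<Rightarrow> 'a set set" where
  "incident_edges H v = {e \<in> edges H. v \<in> e}"

lemma path_between_iff_distinct_walk:
  "path_between H x p y \<longleftrightarrow> walk_between H x p y \<and> distinct p"
  by (auto simp: path_between_def walk_between_def successively_conv_nth)

lemma walk_between_rev:
  assumes "walk_between H x p y"
  shows "walk_between H y (rev p) x"
  using assms by (simp add: walk_between_def hd_rev last_rev insert_commute)

lemma walk_between_append_tl:
  assumes "walk_between H x p y" and "walk_between H y q z"
  shows "walk_between H x (p @ tl q) z"
  using assms by (cases q) (auto simp: walk_between_def successively_append_iff successively_Cons)

lemma walk_between_cut_cycle:
  assumes "walk_between H x (as @ [v] @ bs @ [v] @ cs) y"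
  shows "walk_between H x (as @ [v] @ cs) y"
  using assms by (auto simp: walk_between_def successively_append_iff successively_Cons hd_append)

lemma reachable_refl: "v \<in> verts H \<Longrightarrow> reachable H v v"
  unfolding reachable_def by (rule exI[of _ "[v]"]) (simp add: walk_between_def)

lemma reachable_edge:
  "{u, v} \<in> edges H \<Longrightarrow> u \<in> verts H \<Longrightarrow> v \<in> verts H \<Longrightarrow> reachable H u v"
  unfolding reachable_def by (rule exI[of _ "[u, v]"]) (simp add: walk_between_def)

lemma reachable_sym: "reachable H x y \<Longrightarrow> reachable H y x"
  unfolding reachable_def by (blast intro: walk_between_rev)

lemma reachable_trans: "reachable H x y \<Longrightarrow> reachable H y z \<Longrightarrow> reachable H x z"
  unfolding reachable_def by (blast intro: walk_between_append_tl)

lemma walk_between_imp_ex_path_between: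
  assumes "walk_between H x p y"
  shows "\<exists>q. path_between H x q y"
  using assms
proof (induction p rule: length_induct)
  case (1 p)
  show ?case
  proof (cases "distinct p")
    case True
    with "1.prems" show ?thesis
      by (auto simp: path_between_iff_distinct_walk)
  next
    case False
    then obtain as v bs cs where p: "p = as @ [v] @ bs @ [v] @ cs"
      by (blast dest: not_distinct_decomp)
    with "1.prems" have "walk_between H x (as @ [v] @ cs) y"
      by (simp only: walk_between_cut_cycle)
    moreover have "length (as @ [v] @ cs) < length p"
      by (simp add: p)
    ultimately show ?thesis
      using "1.IH" by blast
  qed
qed

lemma reachable_iff_ex_path_between: "reachable H x y \<longleftrightarrow> (\<exists>p. path_between H x p y)"
  using walk_between_imp_ex_path_between path_between_iff_distinct_walk
  unfolding reachable_def by metis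

lemma path_between_mono:
  assumes "path_between H x p y" and "verts H \<subseteq> verts K" and "edges H \<subseteq> edges K"
  shows "path_between K x p y"
  using assms by (auto simp: path_between_def)

lemma path_between_imp_ex_shortest:
  assumes "path_between H x p y"
  shows "\<exists>q. shortest_path_between H x q y"
  using ex_has_least_nat[of "\<lambda>q. path_between H x q y", OF assms]
  unfolding shortest_path_between_def .

lemma connected_graph_imp_ex_shortest_path:
  assumes "connected_graph H" and "x \<in> verts H" and "y \<in> verts H"
  shows "\<exists>p. shortest_path_between H x p y"
  using assms path_between_imp_ex_shortest unfolding connected_graph_def by metis

lemma finite_paths:
  assumes "finite (verts H)"
  shows "finite {p. \<exists>x y. path_between H x p y}"
  by (rule finite_subset[OF _ finite_subset_distinct[OF assms]]) (auto simp: path_between_def)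

lemma simple_graph_imp_finite_edges:
  assumes "simple_graph G"
  shows "finite (edges G)"
  by (rule finite_subset[of _ "Pow (verts G)"]) (use assms in \<open>auto simp: simple_graph_def\<close>)

lemma reachable_subdivision_half_edge:
  assumes "simple_graph G" and "e \<in> edges G" and "v \<in> e"
  shows "reachable (subdivision G) (Orig v) (Subdiv e)"
  using assms by (intro reachable_edge) (auto simp: simple_graph_def subdivision_def)

lemma reachable_subdivision_Orig:
  assumes "simple_graph G" and "reachable G x y"
  shows "reachable (subdivision G) (Orig x) (Orig y)"
proof -
  have "reachable (subdivision G) (Orig x) (Orig y)" if "walk_between G x p y" for p
    using that
  proof (induction p arbitrary: x rule: induct_list012)
    case 1
    then show ?case
      by (simp add: walk_between_def)
  next
    case (2 v)
    then show ?case
      by (auto simp: walk_between_def subdivision_def intro: reachable_refl)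
  next
    case (3 u v p)
    then have "x = u" and "{u, v} \<in> edges G" and "walk_between G v (v # p) y"
      by (auto simp: walk_between_def)
    then have "reachable (subdivision G) (Orig u) (Subdiv {u, v})"
      and "reachable (subdivision G) (Subdiv {u, v}) (Orig v)"
      using assms(1) by (auto intro: reachable_subdivision_half_edge reachable_sym)
    moreover have "reachable (subdivision G) (Orig v) (Orig y)"
      using "3.IH"(2) \<open>walk_between G v (v # p) y\<close> .
    ultimately show ?case
      unfolding \<open>x = u\<close> by (blast intro: reachable_trans)
  qed
  then show ?thesis
    using assms(2) unfolding reachable_def by blast
qed

lemma reachable_subdivision_ex_Orig:
  assumes "simple_graph G" and "u \<in> verts (subdivision G)"
  shows "\<exists>x\<in>verts G. reachable (subdivision G) u (Orig x)"
proof -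
  consider x where "x \<in> verts G" "u = Orig x" | e where "e \<in> edges G" "u = Subdiv e"
    using assms(2) by (auto simp: subdivision_def)
  then show ?thesis
  proof cases
    case (1 x)
    then show ?thesis
      using assms(2) by (auto intro: reachable_refl)
  next
    case (2 e)
    then have "e \<noteq> {}" and "e \<subseteq> verts G"
      using assms(1) by (auto simp: simple_graph_def)
    then obtain x where "x \<in> e" and "x \<in> verts G"
      by blast
    with 2 show ?thesis
      using assms(1) reachable_subdivision_half_edge reachable_sym by metis
  qed
qed

lemma connected_graph_subdivision:
  assumes "simple_graph G" and "connected_graph G"
  shows "connected_graph (subdivision G)"
proof -
  have "reachable (subdivision G) u v"
    if u: "u \<in> verts (subdivision G)" and v: "v \<in> verts (subdivision G)" for u v
  proof -
    obtain x where "x \<in> verts G" and "reachable (subdivision G) u (Orig x)"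
      using reachable_subdivision_ex_Orig[OF assms(1) u] by blast
    moreover obtain y where "y \<in> verts G" and "reachable (subdivision G) v (Orig y)"
      using reachable_subdivision_ex_Orig[OF assms(1) v] by blast
    moreover from calculation have "reachable G x y"
      using assms(2) by (simp add: connected_graph_def reachable_iff_ex_path_between)
    ultimately show ?thesis
      using reachable_subdivision_Orig[OF assms(1)] reachable_sym reachable_trans by metis
  qed
  moreover have "verts (subdivision G) \<noteq> {}"
    using assms(2) by (simp add: connected_graph_def subdivision_def)
  ultimately show ?thesis
    by (simp add: connected_graph_def reachable_iff_ex_path_between)
qed

lemma finite_subdiv_shortest_paths:
  assumes "simple_graph G"
  shows "finite (subdiv_shortest_paths G)"
proof (rule finite_subset)
  show "subdiv_shortest_paths G \<subseteq> {p. \<exists>x y. path_between (subdivision G) x p y}"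
    by (auto simp: subdiv_shortest_paths_def shortest_path_between_def)
  show "finite {p. \<exists>x y. path_between (subdivision G) x p y}"
    using assms simple_graph_imp_finite_edges[OF assms]
    by (intro finite_paths) (simp add: subdivision_def simple_graph_def)
qed

lemma interval_coloring_incident_colors:
  assumes "interval_coloring H t c" and "v \<in> verts H"
  obtains a where "c ` incident_edges H v = {a..<a + degree H v}"
proof -
  obtain a b where interval: "c ` incident_edges H v = {a..b}"
    using assms unfolding interval_coloring_def incident_edges_def by blast
  have "inj_on c (incident_edges H v)"
    using assms(1)
    unfolding interval_coloring_def proper_edge_coloring_def incident_edges_def inj_on_def by blast
  then have "degree H v = card (c ` incident_edges H v)"
    by (simp add: card_image degree_def incident_edges_def)
  then have "c ` incident_edges H v = {a..<a + degree H v}"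
    by (auto simp: interval)
  then show thesis ..
qed

lemma interval_coloring_diff_le_degree:
  assumes "interval_coloring H t c" and "v \<in> verts H"
    and "g \<in> incident_edges H v" and "h \<in> incident_edges H v"
  shows "int (c h) - int (c g) \<le> int (degree H v) - 1"
proof -
  obtain a where "c ` incident_edges H v = {a..<a + degree H v}"
    using assms(1,2) by (rule interval_coloring_incident_colors)
  then have "c g \<in> {a..<a + degree H v}" and "c h \<in> {a..<a + degree H v}"
    using assms(3,4) by blast+
  then show ?thesis
    by simp
qed

lemma interval_coloring_ex_diff_eq_degree:
  assumes "interval_coloring H t c" and "v \<in> verts H" and "degree H v > 0"
  shows "\<exists>g\<in>incident_edges H v. \<exists>h\<in>incident_edges H v.
           int (c h) - int (c g) = int (degree H v) - 1"
proof -
  obtain a where a: "c ` incident_edges H v = {a..<a + degree H v}"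
    using assms(1,2) by (rule interval_coloring_incident_colors)
  have "a \<in> c ` incident_edges H v" and "a + degree H v - 1 \<in> c ` incident_edges H v"
    using assms(3) by (auto simp: a)
  then obtain g h where "g \<in> incident_edges H v" "c g = a"
    and "h \<in> incident_edges H v" "c h = a + degree H v - 1"
    by auto
  moreover have "int (a + degree H v - 1) - int a = int (degree H v) - 1"
    using assms(3) by simp
  ultimately show ?thesis
    by metis
qed

lemma interval_coloring_diff_le_walk:
  assumes "interval_coloring H t c" and "walk_between H x p y"
    and "g \<in> incident_edges H x" and "h \<in> incident_edges H y"
  shows "int (c h) - int (c g) \<le> (\<Sum>v\<leftarrow>p. int (degree H v) - 1)"
  using assms(2,3)
proof (induction p arbitrary: x g rule: induct_list012)
  case 1
  then show ?case
    by (simp add: walk_between_def)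
next
  case (2 v)
  then have "v \<in> verts H" and "x = v" and "y = v"
    by (auto simp: walk_between_def)
  then show ?case
    using interval_coloring_diff_le_degree[OF assms(1)] "2.prems"(2) assms(4) by simp
next
  case (3 u v p)
  then have "u \<in> verts H" and "x = u" and "{u, v} \<in> edges H" and "walk_between H v (v # p) y"
    by (auto simp: walk_between_def)
  then have "{u, v} \<in> incident_edges H u" and "{u, v} \<in> incident_edges H v"
    by (simp_all add: incident_edges_def)
  have "int (c {u, v}) - int (c g) \<le> int (degree H u) - 1"
    using interval_coloring_diff_le_degree[OF assms(1) \<open>u \<in> verts H\<close>]
      "3.prems"(2) \<open>x = u\<close> \<open>{u, v} \<in> incident_edges H u\<close> by simp
  moreover have "int (c h) - int (c {u, v}) \<le> (\<Sum>w\<leftarrow>v # p. int (degree H w) - 1)"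
    using "3.IH"(2) \<open>walk_between H v (v # p) y\<close> \<open>{u, v} \<in> incident_edges H v\<close> .
  ultimately show ?case
    by simp
qed

lemma interval_coloring_diff_le_path:
  assumes "interval_coloring H t c" and "path_between H x p y"
    and "g \<in> incident_edges H x" and "h \<in> incident_edges H y"
  shows "int (c h) - int (c g) \<le> (\<Sum>v\<in>set p. int (degree H v) - 1)"
proof -
  have "walk_between H x p y" and "distinct p"
    using assms(2) by (simp_all add: path_between_iff_distinct_walk)
  then show ?thesis
    using interval_coloring_diff_le_walk[OF assms(1) _ assms(3,4)]
    by (simp flip: sum_list_distinct_conv_sum_set)
qed

lemma incident_edges_hat_graph_Apex:
  "incident_edges (hat_graph G) Apex = (\<lambda>e. {Apex, Subdiv e}) ` edges G"
  by (auto simp: incident_edges_def hat_graph_def subdivision_def)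

lemma degree_hat_graph_Apex: "degree (hat_graph G) Apex = card (edges G)"
proof -
  have "inj_on (\<lambda>e. {Apex, Subdiv e}) (edges G)"
    by (auto simp: inj_on_def doubleton_eq_iff)
  then show ?thesis
    by (simp add: degree_def card_image incident_edges_hat_graph_Apex flip: incident_edges_def)
qed

lemma path_between_subdivision_imp_hat_graph:
  "path_between (subdivision G) x p y \<Longrightarrow> path_between (hat_graph G) x p y"
  by (erule path_between_mono) (auto simp: hat_graph_def)

lemma interval_colorable_imp_edges_nonempty:
  "H \<in> interval_colorable \<Longrightarrow> edges H \<noteq> {}"
  by (auto simp: interval_colorable_def interval_coloring_def)

lemma hat_graph_interval_colorable_card_edges_le:
  assumes "hat_graph G \<in> interval_colorable" and "finite (edges G)"
  shows "\<exists>e\<in>edges G. \<exists>f\<in>edges G. \<forall>p. path_between (subdivision G) (Subdiv e) p (Subdiv f) \<longrightarrow>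
           int (card (edges G)) \<le> 1 + (\<Sum>v\<in>set p. int (degree (hat_graph G) v) - 1)"
proof -
  obtain t c where coloring: "interval_coloring (hat_graph G) t c"
    using assms(1) by (auto simp: interval_colorable_def)
  have "edges G \<noteq> {}"
    using interval_colorable_imp_edges_nonempty[OF assms(1)]
    by (auto simp: hat_graph_def subdivision_def)
  then have "degree (hat_graph G) Apex > 0"
    using assms(2) by (simp add: degree_hat_graph_Apex card_gt_0_iff)
  moreover have "Apex \<in> verts (hat_graph G)"
    by (simp add: hat_graph_def)
  ultimately obtain e f where e: "e \<in> edges G" and f: "f \<in> edges G"
    and spread: "int (c {Apex, Subdiv f}) - int (c {Apex, Subdiv e}) = int (card (edges G)) - 1"
    using interval_coloring_ex_diff_eq_degree[OF coloring]
    by (force simp: incident_edges_hat_graph_Apex degree_hat_graph_Apex)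
  have incident: "{Apex, Subdiv d} \<in> incident_edges (hat_graph G) (Subdiv d)"
    if "d \<in> edges G" for d
    using that by (auto simp: incident_edges_def hat_graph_def)
  have "int (card (edges G)) \<le> 1 + (\<Sum>v\<in>set p. int (degree (hat_graph G) v) - 1)"
    if "path_between (subdivision G) (Subdiv e) p (Subdiv f)" for p
    using interval_coloring_diff_le_path[OF coloring
        path_between_subdivision_imp_hat_graph[OF that] incident[OF e] incident[OF f]]
    by (simp add: spread)
  with e f show ?thesis
    by blast
qed

theorem theorem10:
  fixes G :: "'a ugraph"
  assumes "simple_graph G"
    and "connected_graph G"
    and "int (card (edges G)) >
           1 + Max ((\<lambda>P. \<Sum>v\<in>set P. (int (degree (hat_graph G) v) - 1)) ` subdiv_shortest_paths G)"
  shows "hat_graph G \<notin> interval_colorable"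
proof
  let ?weight = "\<lambda>P. \<Sum>v\<in>set P. (int (degree (hat_graph G) v) - 1)"
  assume "hat_graph G \<in> interval_colorable"
  then obtain e f where "e \<in> edges G" "f \<in> edges G"
    and bound: "\<And>p. path_between (subdivision G) (Subdiv e) p (Subdiv f) \<Longrightarrow>
      int (card (edges G)) \<le> 1 + ?weight p"
    using hat_graph_interval_colorable_card_edges_le[OF _ simple_graph_imp_finite_edges[OF assms(1)]]
    by blast
  then have "Subdiv e \<in> verts (subdivision G)" and "Subdiv f \<in> verts (subdivision G)"
    by (simp_all add: subdivision_def)
  then obtain p where p: "shortest_path_between (subdivision G) (Subdiv e) p (Subdiv f)"
    using connected_graph_imp_ex_shortest_path[OF connected_graph_subdivision[OF assms(1,2)]]
    by blast
  with \<open>e \<in> edges G\<close> \<open>f \<in> edges G\<close> have "p \<in> subdiv_shortest_paths G"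
    by (auto simp: subdiv_shortest_paths_def)
  have "int (card (edges G)) \<le> 1 + ?weight p"
    using p bound by (simp add: shortest_path_between_def)
  also have "?weight p \<le> Max (?weight ` subdiv_shortest_paths G)"
    using \<open>p \<in> subdiv_shortest_paths G\<close> finite_subdiv_shortest_paths[OF assms(1)] by simp
  finally show False
    using assms(3) by simp
qed

end
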